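(* Let $n\ge 1$ and suppose that $\hat f,\hat g:\hat{\mathbb Q}^n\to\hat{\mathbb R}$ are two standard dual quaternion functions. Then the functions $\hat{\mathbf x}\mapsto \hat f(\hat{\mathbf x})+\hat g(\hat{\mathbf x})$, $\hat{\mathbf x}\mapsto \hat f(\hat{\mathbf x})\hat g(\hat{\mathbf x})$, $\hat{\mathbf x}\mapsto\min\{\hat f(\hat{\mathbf x}),\hat g(\hat{\mathbf x})\}$ and $\hat{\mathbf x}\mapsto\max\{\hat f(\hat{\mathbf x}),\hat g(\hat{\mathbf x})\}$ from $\hat{\mathbb Q}^n$ to $\hat{\mathbb R}$ are also standard dual quaternion functions.
   Context: Dual numbers: $\hat{\mathbb R}$ is the set of $\hat q=q+q_d\epsilon$ with $q,q_d\in\mathbb R$, where $\epsilon^2=0$; $q$ is the standard part and $q_d$ the dual part. Dual quaternions: $\hat{\mathbb Q}$ is the set of $\hat q=q+q_d\epsilon$ with $q,q_d\in\mathbb Q$, the real quaternions (note: $\mathbb Q$ denotes quaternions here), where $\epsilon^2=0$ and $\epsilon$ commutes with quaternions. Addition is componentwise and $(p+p_d\epsilon)(q+q_d\epsilon)=pq+(pq_d+p_dq)\epsilon$. $\hat{\mathbb Q}^n$ is the set of $n$-dimensional vectors of dual quaternions; write $\hat{\mathbf x}=\mathbf x+\epsilon\mathbf x_d$ with $\mathbf x,\mathbf x_d\in\mathbb Q^n$. An element $\mathbf x\in\mathbb Q^n$ is identified with $\mathbf x+\epsilon\mathbf 0\in\hat{\mathbb Q}^n$. Total order on $\hat{\mathbb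 R}$: $p+p_d\epsilon\le q+q_d\epsilon$ iff $p<q$, or $p=q$ and $p_d\le q_d$. Minimum and maximum are with respect to this order. A dual quaternion function is a function $\hat f:\hat{\mathbb Q}^n\to\hat{\mathbb R}$; write $\hat f(\hat{\mathbf x})=f(\hat{\mathbf x})+\epsilon f_d(\hat{\mathbf x})$ with $f(\hat{\mathbf x}),f_d(\hat{\mathbf x})\in\mathbb R$ the standard and dual parts. It is a standard dual quaternion function if $f(\hat{\mathbf x})=f(\mathbf x)$ for all $\hat{\mathbf x}=\mathbf x+\epsilon\mathbf x_d\in\hat{\mathbb Q}^n$, i.e. the standard part of the value depends only on the standard part of the variable. *)

theory Defs
  imports "HOL-Analysis.Analysis"
begin

datatype quat = Quat (qre: real) (qi: real) (qj: real) (qk: real)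

instantiation quat :: ring_1
begin

definition "0 = Quat 0 0 0 0"

definition "1 = Quat 1 0 0 0"

definition "p + q = Quat (qre p + qre q) (qi p + qi q) (qj p + qj q) (qk p + qk q)"

definition "- p = Quat (- qre p) (- qi p) (- qj p) (- qk p)"

definition "p - q = Quat (qre p - qre q) (qi p - qi q) (qj p - qj q) (qk p - qk q)"

definition "p * q = Quat
  (qre p * qre q - qi p * qi q - qj p * qj q - qk p * qk q)
  (qre p * qi q + qi p * qre q + qj p * qk q - qk p * qj q)
  (qre p * qj q - qi p * qk q + qj p * qre q + qk p * qi q)
  (qre p * qk q + qi p * qj q - qj p * qi q + qk p * qre q)"

instance
  by standard
    (simp_all add: zero_quat_def one_quat_def plus_quat_def uminus_quat_def minus_quat_def
      times_quat_def algebra_simps)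

end

lemma quat_units:
  "Quat 0 1 0 0 * Quat 0 1 0 0 = - 1"
  "Quat 0 0 1 0 * Quat 0 0 1 0 = - 1"
  "Quat 0 0 0 1 * Quat 0 0 0 1 = - 1"
  "Quat 0 1 0 0 * Quat 0 0 1 0 * Quat 0 0 0 1 = - 1"
  by (simp_all add: one_quat_def uminus_quat_def times_quat_def)

text \<open>
  \<open>Dual q q\<^sub>d\<close> stands for \<open>q + q\<^sub>d \<epsilon>\<close> with \<open>\<epsilon>\<^sup>2 = 0\<close> and \<open>\<epsilon>\<close> central. Thus \<^typ>\<open>real\<close>
  gives the dual numbers and \<^typ>\<open>quat\<close> gives the dual quaternions.
\<close>

datatype 'a dual = Dual (std_part: 'a) (dual_part: 'a)

type_synonym dual_number = "real dual"
type_synonym dual_quat = "quat dual"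

instantiation dual :: (ring_1) ring_1
begin

definition "0 = Dual 0 0"

definition "1 = Dual 1 0"

definition "x + y = Dual (std_part x + std_part y) (dual_part x + dual_part y)"

definition "- x = Dual (- std_part x) (- dual_part x)"

definition "x - y = Dual (std_part x - std_part y) (dual_part x - dual_part y)"

definition "x * y = Dual (std_part x * std_part y)
  (std_part x * dual_part y + dual_part x * std_part y)"

instance
  by standard
    (simp_all add: zero_dual_def one_dual_def plus_dual_def uminus_dual_def minus_dual_def
      times_dual_def algebra_simps)

end

instance dual :: (comm_ring_1) comm_ring_1
  by standard (simp_all add: one_dual_def plus_dual_def times_dual_def algebra_simps)

definition dual_eps :: "'a::ring_1 dual" where
  "dual_eps = Dual 0 1"

lemma dual_eps_square: "dual_eps * dual_eps = 0"
  by (simp add: dual_eps_def times_dual_def zero_dual_def)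

lemma dual_eps_commute: "dual_eps * x = x * dual_eps"
  by (simp add: dual_eps_def times_dual_def)

lemma Dual_eq_eps: "Dual q q\<^sub>d = Dual q 0 + Dual q\<^sub>d 0 * dual_eps"
  by (simp add: dual_eps_def times_dual_def plus_dual_def)

instantiation dual :: (linorder) linorder
begin

definition "x \<le> y \<longleftrightarrow>
  std_part x < std_part y \<or> std_part x = std_part y \<and> dual_part x \<le> dual_part y"

definition "x < y \<longleftrightarrow> x \<le> y \<and> x \<noteq> (y :: 'a dual)"

instance
  by standard (auto simp: less_eq_dual_def less_dual_def intro: dual.expand)

end

definition std_vec :: "dual_quat ^ 'n \<Rightarrow> quat ^ 'n" where
  "std_vec x = (\<chi> i. std_part (x $ i))"

definition embed_vec :: "quat ^ 'n \<Rightarrow> dual_quat ^ 'n" where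
  "embed_vec x = (\<chi> i. Dual (x $ i) 0)"

text \<open>
  A quaternion vector \<open>x\<close> is identified with \<open>x + 0 \<epsilon>\<close>, so that \<open>f\<close> may be applied to the standard
  part of its argument.
\<close>

definition standard_dual_quat_function :: "(dual_quat ^ 'n \<Rightarrow> dual_number) \<Rightarrow> bool" where
  "standard_dual_quat_function f \<longleftrightarrow>
    (\<forall>x. std_part (f x) = std_part (f (embed_vec (std_vec x))))"

end

theory Submission
  imports Defs
begin

text \<open>Dropping the dual part is a ring homomorphism and is monotone, hence commutes with +, *,
  min and max. So the standard part of each combination depends only on those of \<open>f x\<close>
  and \<open>g x\<close>, which ignore the dual part of \<open>x\<close>.\<close>

lemma std_part_plus: "std_part (x + y) = std_part x + std_part y"
  by (simp add: plus_dual_def)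

lemma std_part_times: "std_part (x * y) = std_part x * std_part y"
  by (simp add: times_dual_def)

text \<open>The order compares standard parts first; dual parts decide only ties, where either
  choice has the same standard part.\<close>

lemma std_part_min: "std_part (min x y) = min (std_part x) (std_part y)"
  by (auto simp: min_def less_eq_dual_def)

lemma std_part_max: "std_part (max x y) = max (std_part x) (std_part y)"
  by (auto simp: max_def less_eq_dual_def)

theorem theorem3p1:
  fixes f g :: "dual_quat ^ 'n \<Rightarrow> dual_number"
  assumes "standard_dual_quat_function f"
    and "standard_dual_quat_function g"
  shows "standard_dual_quat_function (\<lambda>x. f x + g x) \<and>
    standard_dual_quat_function (\<lambda>x. f x * g x) \<and>
    standard_dual_quat_function (\<lambda>x. min (f x) (g x)) \<and>
    standard_dual_quat_function (\<lambda>x. max (f x) (g x))"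
  using assms unfolding standard_dual_quat_function_def
    std_part_plus std_part_times std_part_min std_part_max
  by metis

end
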